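(* Let $\sigma>0$, $\varepsilon>0$, $\Delta x>0$, $\Delta t>0$. Consider the ImEx1-ctr scheme together with periodic boundary conditions. If $$\Delta t\ \le\ \frac{\sigma\Delta x^2}{4}\cdot\frac{1+\sqrt{1+\left(\frac{4\varepsilon}{\sigma\Delta x}\right)^2}}{2},$$ then the scheme is $l^2$-diminishing, that is, for every $n\ge0$, $$\sum_{j=1}^N\left((E_j^{n+1})^2+(F_j^{n+1})^2\right)\Delta x\ \le\ \sum_{j=1}^N\left((E_j^{n})^2+(F_j^{n})^2\right)\Delta x .$$
   Context: The unknowns are real grid values $E_j^n,F_j^n$ with cells $1\le j\le N$ and time levels $n\ge 0$; $\sigma$ is constant. Put $M=\frac{1}{1+\sigma\Delta t/\varepsilon^2}$. The ImEx1-ctr scheme (for the hyperbolic heat equations $\partial_tE+\frac1\varepsilon\partial_xF=0$, $\partial_tF+\frac1\varepsilon\partial_xE=-\frac{\sigma}{\varepsilon^2}F$) is, for $1\le j\le N$, $n\ge 0$, $$\frac{E_j^{n+1}-E_j^n}{\Delta t}+\frac{M}{\varepsilon}\frac{F_{j+1}^n-F_{j-1}^n}{2\Delta x}-\frac{M\Delta t}{\varepsilon^2}\frac{E_{j+1}^n-2E_j^n+E_{j-1}^n}{\Delta x^2}=0,$$ $$\frac{F_j^{n+1}-F_j^n}{\Delta t}+\frac{M}{\varepsilon}\frac{E_{j+1}^n-E_{j-1}^n}{2\Delta x}-\frac{M\Delta t}{\varepsilon^2}\frac{F_{j+1}^n-2F_j^n+F_{j-1}^n}{\Delta x^2}=-\frac{M\sigma}{\varepsilon^2}F_j^n.$$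 Periodic boundary conditions: at every time level, $E_0^n=E_N^n$, $F_0^n=F_N^n$, $E_{N+1}^n=E_1^n$, $F_{N+1}^n=F_1^n$. *)

theory Defs
  imports Complex_Main
begin

definition imex_M :: "real \<Rightarrow> real \<Rightarrow> real \<Rightarrow> real" where
  "imex_M \<sigma> \<epsilon> dt = 1 / (1 + \<sigma> * dt / \<epsilon>\<^sup>2)"

(* Grid functions are written u n j for the value in cell j at time level n.  Only j = 0, ..., N + 1
   matters: the cells are 1, ..., N, and 0 and N + 1 are the ghost cells set by periodicity.
   The subtraction j - 1 on nat is exact, as the scheme is imposed for 1 \<le> j only. *)
definition imex1_ctr ::
  "nat \<Rightarrow> real \<Rightarrow> real \<Rightarrow> real \<Rightarrow> real \<Rightarrow> (nat \<Rightarrow> nat \<Rightarrow> real) \<Rightarrow> (nat \<Rightarrow> nat \<Rightarrow> real) \<Rightarrow> bool" where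
  "imex1_ctr N \<sigma> \<epsilon> dx dt E F \<longleftrightarrow>
    (let M = imex_M \<sigma> \<epsilon> dt in
      \<forall>n. \<forall>j\<in>{1..N}.
        (E (n + 1) j - E n j) / dt
          + (M / \<epsilon>) * ((F n (j + 1) - F n (j - 1)) / (2 * dx))
          - (M * dt / \<epsilon>\<^sup>2) * ((E n (j + 1) - 2 * E n j + E n (j - 1)) / dx\<^sup>2) = 0 \<and>
        (F (n + 1) j - F n j) / dt
          + (M / \<epsilon>) * ((E n (j + 1) - E n (j - 1)) / (2 * dx))
          - (M * dt / \<epsilon>\<^sup>2) * ((F n (j + 1) - 2 * F n j + F n (j - 1)) / dx\<^sup>2)
          = - (M * \<sigma> / \<epsilon>\<^sup>2) * F n j)"

definition periodic_bc :: "nat \<Rightarrow> (nat \<Rightarrow> nat \<Rightarrow> real) \<Rightarrow> bool" where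
  "periodic_bc N u \<longleftrightarrow> (\<forall>n. u n 0 = u n N \<and> u n (N + 1) = u n 1)"

end

(* With s = \<sigma> dt / \<epsilon>^2, M = 1 / (1 + s), a = M dt / (\<epsilon> dx) and b = M dt^2 / (\<epsilon> dx)^2, the scheme
   reads E' = E - a cdiff F + b lap E, F' = M F - a cdiff E + b lap F.  Here a^2 = M b, and the bound
   on dt says exactly b \<le> 1/4.  In the energy balance, summation by parts leaves the single cross
   term 2 a (1 - M) \<Sum> F cdiff E, which Young's inequality splits into M (1 - M)^2 F^2 and
   b (cdiff E)^2; the first part is paid for by the relaxation of F and the second by the diffusion
   of E. *)

theory Submission
  imports Defs
begin

section \<open>Undivided differences and summation by parts on the periodic grid\<close>

definition cdiff :: "(nat \<Rightarrow> real) \<Rightarrow> nat \<Rightarrow> real" where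
  "cdiff u j = (u (j + 1) - u (j - 1)) / 2"

definition lap :: "(nat \<Rightarrow> real) \<Rightarrow> nat \<Rightarrow> real" where
  "lap u j = u (j + 1) - 2 * u j + u (j - 1)"

definition fdiff :: "(nat \<Rightarrow> real) \<Rightarrow> nat \<Rightarrow> real" where
  "fdiff u j = u (j + 1) - u j"

definition periodic :: "nat \<Rightarrow> (nat \<Rightarrow> real) \<Rightarrow> bool" where
  "periodic N u \<longleftrightarrow> u 0 = u N \<and> u (N + 1) = u 1"

lemma sum_shift_pred:
  fixes h :: "nat \<Rightarrow> real"
  assumes "h 0 = h N"
  shows "(\<Sum>j=1..N. h (j - 1)) = (\<Sum>j=1..N. h j)"
proof -
  \<comment> \<open>Periodicity ties \<open>h 0\<close> to one fixed \<open>N\<close> and would not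
    survive induction. With the two boundary terms explicit, the identity holds for every
    \<open>N\<close>.\<close>
  have "(\<Sum>j=1..N. h (j - 1)) + h N = (\<Sum>j=1..N. h j) + h 0" for N
    by (induction N) auto
  with assms show ?thesis by (metis add_right_cancel)
qed

text \<open>Common form of all summations by parts below: each exhibits its summand as the backward
  difference of a flux \<open>h\<close> that agrees at both ends of the period.\<close>

lemma sum_telescope_periodic:
  fixes h :: "nat \<Rightarrow> real"
  assumes "h 0 = h N" and "\<And>j. 1 \<le> j \<Longrightarrow> g j = h j - h (j - 1)"
  shows "(\<Sum>j=1..N. g j) = 0"
proof -
  have "(\<Sum>j=1..N. g j) = (\<Sum>j=1..N. h j - h (j - 1))"
    by (rule sum.cong) (use assms(2) in auto)
  then show ?thesis by (simp only: sum_subtractf sum_shift_pred[of h N, OF assms(1)] diff_self)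
qed

lemma sum_cd_antisym:
  assumes "periodic N u" and "periodic N v"
  shows "(\<Sum>j=1..N. u j * cdiff v j) = - (\<Sum>j=1..N. v j * cdiff u j)"
proof -
  have "(\<Sum>j=1..N. u j * cdiff v j + v j * cdiff u j) = 0"
    by (rule sum_telescope_periodic[where h = "\<lambda>j. (u j * v (j + 1) + v j * u (j + 1)) / 2"])
      (use assms in \<open>auto simp: periodic_def cdiff_def field_simps\<close>)
  then show ?thesis by (simp add: sum.distrib)
qed

text \<open>\<open>lap\<close> is symmetric, \<open>cdiff\<close> antisymmetric, and they commute,
  so their product is antisymmetric. The flux in the proof is the expanded product
  \<open>fdiff u j * fdiff v j\<close>.\<close>

lemma sum_lap_cd_antisym:
  assumes "periodic N u" and "periodic N v"
  shows "(\<Sum>j=1..N. lap u j * cdiff v j) = - (\<Sum>j=1..N. lap v j * cdiff u j)"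
proof -
  have "(\<Sum>j=1..N. lap u j * cdiff v j + lap v j * cdiff u j) = 0"
    by (rule sum_telescope_periodic[where
          h = "\<lambda>j. u j * v j + u (j + 1) * v (j + 1) - (u j * v (j + 1) + v j * u (j + 1))"])
      (use assms in \<open>auto simp: periodic_def cdiff_def lap_def field_simps\<close>)
  then show ?thesis by (simp add: sum.distrib)
qed

lemma sum_mult_lap:
  assumes "periodic N u"
  shows "(\<Sum>j=1..N. u j * lap u j) = - (\<Sum>j=1..N. (fdiff u j)\<^sup>2)"
proof -
  have "(\<Sum>j=1..N. u j * lap u j + (fdiff u j)\<^sup>2) = 0"
    by (rule sum_telescope_periodic[where h = "\<lambda>j. u (j + 1) * fdiff u j"])
      (use assms in \<open>auto simp: periodic_def fdiff_def lap_def power2_eq_square algebra_simps\<close>)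
  then show ?thesis by (simp add: sum.distrib)
qed

lemma sum_fd_sq_shift:
  assumes "periodic N u"
  shows "(\<Sum>j=1..N. (fdiff u (j - 1))\<^sup>2) = (\<Sum>j=1..N. (fdiff u j)\<^sup>2)"
  by (rule sum_shift_pred[of "\<lambda>j. (fdiff u j)\<^sup>2"]) (use assms in \<open>auto simp: periodic_def fdiff_def\<close>)

text \<open>\<open>cdiff u j\<close> is the mean and \<open>lap u j\<close> the difference of the
  neighbouring values \<open>fdiff u j\<close> and \<open>fdiff u (j - 1)\<close>; the parallelogram
  law relates their squares.\<close>

lemma sum_cd_sq:
  assumes "periodic N u"
  shows "(\<Sum>j=1..N. (cdiff u j)\<^sup>2) = (\<Sum>j=1..N. (fdiff u j)\<^sup>2) - (\<Sum>j=1..N. (lap u j)\<^sup>2) / 4"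
proof -
  have "(\<Sum>j=1..N. (cdiff u j)\<^sup>2)
      = (\<Sum>j=1..N. (fdiff u j)\<^sup>2 / 2 + (fdiff u (j - 1))\<^sup>2 / 2 - (lap u j)\<^sup>2 / 4)"
    by (rule sum.cong) (auto simp: cdiff_def fdiff_def lap_def power2_eq_square field_simps)
  also have "\<dots> = (\<Sum>j=1..N. (fdiff u j)\<^sup>2) - (\<Sum>j=1..N. (lap u j)\<^sup>2) / 4"
    by (simp only: sum.distrib sum_subtractf flip: sum_divide_distrib)
      (simp add: sum_fd_sq_shift[OF assms] del: One_nat_def)
  finally show ?thesis .
qed

lemma sum_lap_sq_le:
  assumes "periodic N u"
  shows "(\<Sum>j=1..N. (lap u j)\<^sup>2) \<le> 4 * (\<Sum>j=1..N. (fdiff u j)\<^sup>2)"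
  using sum_cd_sq[OF assms] sum_nonneg[of "{1..N}" "\<lambda>j. (cdiff u j)\<^sup>2"] by simp

lemma sum_fd_sq_le:
  assumes "periodic N u"
  shows "(\<Sum>j=1..N. (fdiff u j)\<^sup>2) \<le> 4 * (\<Sum>j=1..N. (u j)\<^sup>2)"
proof -
  have eq: "(\<Sum>j=1..N. (u (j + 1))\<^sup>2) = (\<Sum>j=1..N. (u j)\<^sup>2)"
  proof -
    have "(\<Sum>j=1..N. (u (j - 1 + 1))\<^sup>2) = (\<Sum>j=1..N. (u (j + 1))\<^sup>2)"
      by (rule sum_shift_pred[of "\<lambda>j. (u (j + 1))\<^sup>2"]) (use assms in \<open>simp add: periodic_def\<close>)
    moreover have "(\<Sum>j=1..N. (u (j - 1 + 1))\<^sup>2) = (\<Sum>j=1..N. (u j)\<^sup>2)"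
      by (rule sum.cong) auto
    ultimately show ?thesis by simp
  qed
  have "(\<Sum>j=1..N. (fdiff u j)\<^sup>2) \<le> (\<Sum>j=1..N. 2 * (u (j + 1))\<^sup>2 + 2 * (u j)\<^sup>2)"
  proof (rule sum_mono)
    fix j
    have "0 \<le> (u (j + 1) + u j)\<^sup>2" by simp
    then show "(fdiff u j)\<^sup>2 \<le> 2 * (u (j + 1))\<^sup>2 + 2 * (u j)\<^sup>2"
      by (simp add: fdiff_def power2_eq_square algebra_simps)
  qed
  also have "\<dots> = 4 * (\<Sum>j=1..N. (u j)\<^sup>2)"
    by (simp only: sum.distrib eq flip: sum_distrib_left)
  finally show ?thesis .
qed

section \<open>Energy balance of one time step\<close>

text \<open>One expansion serves both equations: \<open>c = 1\<close> for the update of E, and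
  \<open>c = M\<close> for that of F.\<close>

lemma sum_sq_step:
  assumes "\<And>j. j \<in> {1..N} \<Longrightarrow> w j = c * u j - a * cdiff v j + b * lap u j" and "periodic N u" and "periodic N v"
  shows "(\<Sum>j=1..N. (w j)\<^sup>2) = c\<^sup>2 * (\<Sum>j=1..N. (u j)\<^sup>2)
      + a\<^sup>2 * ((\<Sum>j=1..N. (fdiff v j)\<^sup>2) - (\<Sum>j=1..N. (lap v j)\<^sup>2) / 4)
      + b\<^sup>2 * (\<Sum>j=1..N. (lap u j)\<^sup>2) - 2 * b * c * (\<Sum>j=1..N. (fdiff u j)\<^sup>2)
      - 2 * a * c * (\<Sum>j=1..N. u j * cdiff v j) - 2 * a * b * (\<Sum>j=1..N. lap u j * cdiff v j)"
proof -
  have "(\<Sum>j=1..N. (w j)\<^sup>2) = (\<Sum>j=1..N. c\<^sup>2 * (u j)\<^sup>2 + a\<^sup>2 * (cdiff v j)\<^sup>2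
      + b\<^sup>2 * (lap u j)\<^sup>2 + 2 * b * c * (u j * lap u j)
      - 2 * a * c * (u j * cdiff v j) - 2 * a * b * (lap u j * cdiff v j))"
    by (rule sum.cong) (auto simp: assms(1) power2_eq_square algebra_simps)
  also have "\<dots> = c\<^sup>2 * (\<Sum>j=1..N. (u j)\<^sup>2) + a\<^sup>2 * (\<Sum>j=1..N. (cdiff v j)\<^sup>2)
      + b\<^sup>2 * (\<Sum>j=1..N. (lap u j)\<^sup>2) + 2 * b * c * (\<Sum>j=1..N. u j * lap u j)
      - 2 * a * c * (\<Sum>j=1..N. u j * cdiff v j) - 2 * a * b * (\<Sum>j=1..N. lap u j * cdiff v j)"
    by (simp only: sum.distrib sum_subtractf flip: sum_distrib_left)
  finally show ?thesis
    by (simp add: sum_cd_sq[OF assms(3)] sum_mult_lap[OF assms(2)] del: One_nat_def)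
qed

text \<open>Since \<bar>a\<bar> factors as \<open>sqrt M * sqrt b\<close>, Young's inequality can
  attach one root to \<open>(1 - M) * f j\<close> and the other to \<open>cdiff e j\<close>.\<close>

lemma cross_term_le:
  assumes "periodic N e" and "0 \<le> M" and "0 \<le> b" and "a\<^sup>2 = M * b"
  shows "2 * a * (1 - M) * (\<Sum>j=1..N. f j * cdiff e j) \<le> M * (1 - M)\<^sup>2 * (\<Sum>j=1..N. (f j)\<^sup>2)
      + b * ((\<Sum>j=1..N. (fdiff e j)\<^sup>2) - (\<Sum>j=1..N. (lap e j)\<^sup>2) / 4)"
proof -
  have "2 * a * (1 - M) * (f j * cdiff e j) \<le> M * (1 - M)\<^sup>2 * (f j)\<^sup>2 + b * (cdiff e j)\<^sup>2" for j
  proof -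
    have a: "\<bar>a\<bar> = sqrt M * sqrt b"
      by (metis assms(4) real_sqrt_abs real_sqrt_mult)
    have "2 * a * (1 - M) * (f j * cdiff e j) \<le> 2 * \<bar>a\<bar> * \<bar>(1 - M) * f j\<bar> * \<bar>cdiff e j\<bar>"
      using abs_ge_self[of "2 * a * (1 - M) * (f j * cdiff e j)"]
      by (simp only: abs_mult abs_numeral mult.assoc)
    also have "\<dots> = 2 * (sqrt M * \<bar>(1 - M) * f j\<bar>) * (sqrt b * \<bar>cdiff e j\<bar>)"
      by (simp add: a)
    also have "\<dots> \<le> (sqrt M * \<bar>(1 - M) * f j\<bar>)\<^sup>2 + (sqrt b * \<bar>cdiff e j\<bar>)\<^sup>2"
      by (rule sum_squares_bound)
    also have "\<dots> = M * (1 - M)\<^sup>2 * (f j)\<^sup>2 + b * (cdiff e j)\<^sup>2"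
      using assms(2,3) by (simp add: power_mult_distrib)
    finally show ?thesis .
  qed
  then have "(\<Sum>j=1..N. 2 * a * (1 - M) * (f j * cdiff e j))
      \<le> (\<Sum>j=1..N. M * (1 - M)\<^sup>2 * (f j)\<^sup>2 + b * (cdiff e j)\<^sup>2)"
    by (rule sum_mono)
  then show ?thesis
    by (simp only: sum.distrib sum_cd_sq[OF assms(1)] flip: sum_distrib_left)
qed

lemma energy_step:
  assumes e': "\<And>j. j \<in> {1..N} \<Longrightarrow> e' j = e j - a * cdiff f j + b * lap e j"
    and f': "\<And>j. j \<in> {1..N} \<Longrightarrow> f' j = M * f j - a * cdiff e j + b * lap f j"
    and per: "periodic N e" "periodic N f"
    and M: "0 \<le> M" "M \<le> 1" and b: "0 \<le> b" "b \<le> 1 / 4" and ab: "a\<^sup>2 = M * b"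
  shows "(\<Sum>j=1..N. (e' j)\<^sup>2 + (f' j)\<^sup>2) \<le> (\<Sum>j=1..N. (e j)\<^sup>2 + (f j)\<^sup>2)"
proof -
  define Ae Af De Df Qe Qf X Y where
    "Ae = (\<Sum>j=1..N. (e j)\<^sup>2)" and "Af = (\<Sum>j=1..N. (f j)\<^sup>2)" and
    "De = (\<Sum>j=1..N. (fdiff e j)\<^sup>2)" and "Df = (\<Sum>j=1..N. (fdiff f j)\<^sup>2)" and
    "Qe = (\<Sum>j=1..N. (lap e j)\<^sup>2)" and "Qf = (\<Sum>j=1..N. (lap f j)\<^sup>2)" and
    "X = (\<Sum>j=1..N. f j * cdiff e j)" and "Y = (\<Sum>j=1..N. lap f j * cdiff e j)"
  note defs = this
  have nonneg: "0 \<le> Af" "0 \<le> De" "0 \<le> Qe" "0 \<le> Qf"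
    by (simp_all add: defs sum_nonneg)
  have Qf: "Qf \<le> 4 * Df" "Df \<le> 4 * Af"
    using sum_lap_sq_le[OF per(2)] sum_fd_sq_le[OF per(2)] by (simp_all add: defs)
  \<comment> \<open>Antisymmetry moves \<open>cdiff\<close> onto \<open>e\<close>, so that both
    balances contain the same \<open>X\<close> and \<open>Y\<close>: the \<open>Y\<close> terms
    cancel in the sum, and \<open>X\<close> keeps the factor \<open>1 - M\<close>.\<close>
  have E: "(\<Sum>j=1..N. (e' j)\<^sup>2) = Ae + M * b * (Df - Qf / 4) + b\<^sup>2 * Qe - 2 * b * De
      + 2 * a * X + 2 * a * b * Y"
    using sum_sq_step[of N e' 1 e a f b] e' per ab
    by (simp add: sum_cd_antisym[OF per] sum_lap_cd_antisym[OF per] defs del: One_nat_def)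
  have F: "(\<Sum>j=1..N. (f' j)\<^sup>2) = M\<^sup>2 * Af + M * b * (De - Qe / 4) + b\<^sup>2 * Qf - 2 * b * M * Df
      - 2 * a * M * X - 2 * a * b * Y"
    using sum_sq_step[of N f' M f a e b] f' per ab by (simp add: defs)
  have X: "2 * a * (1 - M) * X \<le> M * (1 - M)\<^sup>2 * Af + b * (De - Qe / 4)"
    using cross_term_le[OF per(1) M(1) b(1) ab, of f] by (simp add: defs)
  \<comment> \<open>What remains of the dissipation of \<open>e\<close> after Young's inequality;
    the coefficient of \<open>Qe\<close> is nonnegative because \<open>b\<close> is at most
    1/4.\<close>
  have e_part: "0 \<le> b * ((1 - M) * De + ((1 + M) / 4 - b) * Qe)"
    using M b nonneg by (intro mult_nonneg_nonneg add_nonneg_nonneg) auto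
  \<comment> \<open>What remains for \<open>f\<close>; the coefficient of \<open>Af\<close> is
    \<open>1 - M\<^sup>2 - M * (1 - M)\<^sup>2\<close>. The only harmful term is the one in
    \<open>Qf\<close>, when \<open>b\<close> exceeds \<open>M / 4\<close>.\<close>
  have f_part: "0 \<le> (1 - M) * (1 + M\<^sup>2) * Af + M * b * Df - b * (b - M / 4) * Qf"
  proof -
    \<comment> \<open>Spending the whole \<open>Df\<close> term raises the threshold for
      \<open>b\<close> from \<open>M / 4\<close> to \<open>M / 2\<close>; beyond it, the relaxation
      term in \<open>Af\<close> has to pay.\<close>
    have "M * b * (Qf / 4) \<le> M * b * Df"
      using M b Qf by (intro mult_left_mono) auto
    moreover have "b * (b - M / 2) * Qf \<le> (1 - M) * (1 + M\<^sup>2) * Af"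
    proof (cases "b \<le> M / 2")
      case True
      then have "b * (b - M / 2) * Qf \<le> 0"
        using b nonneg by (intro mult_nonpos_nonneg mult_nonneg_nonpos) auto
      also have "\<dots> \<le> (1 - M) * (1 + M\<^sup>2) * Af"
        using M nonneg by (intro mult_nonneg_nonneg add_nonneg_nonneg) auto
      finally show ?thesis .
    next
      case False
      \<comment> \<open>Both occurrences of \<open>b\<close> are replaced by their maximum 1/4, and
        \<open>Qf\<close> by \<open>16 * Af\<close>, obtained by chaining the two bounds in
        \<open>Qf\<close>.\<close>
      have "b * (b - M / 2) * Qf \<le> 1 / 4 * (1 / 4 - M / 2) * (16 * Af)"
        using False M b nonneg Qf by (intro mult_mono mult_nonneg_nonneg) auto
      also have "\<dots> = (1 - 2 * M) * Af" by (simp add: algebra_simps)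
      also have "\<dots> \<le> (1 - M) * (1 + M\<^sup>2) * Af"
      proof (rule mult_right_mono)
        have "0 \<le> M + M\<^sup>2 * (1 - M)" using M by simp
        then show "1 - 2 * M \<le> (1 - M) * (1 + M\<^sup>2)"
          by (simp add: algebra_simps)
      qed (rule nonneg)
      finally show ?thesis .
    qed
    ultimately show ?thesis by (simp add: algebra_simps)
  qed
  have "(\<Sum>j=1..N. (e' j)\<^sup>2) + (\<Sum>j=1..N. (f' j)\<^sup>2) \<le> Ae + Af"
  proof -
    \<comment> \<open>The energy loss is exactly the slack in Young's inequality plus the two
      remainders, all nonnegative.\<close>
    have "Ae + Af - ((\<Sum>j=1..N. (e' j)\<^sup>2) + (\<Sum>j=1..N. (f' j)\<^sup>2))
        = (M * (1 - M)\<^sup>2 * Af + b * (De - Qe / 4) - 2 * a * (1 - M) * X)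
        + b * ((1 - M) * De + ((1 + M) / 4 - b) * Qe)
        + ((1 - M) * (1 + M\<^sup>2) * Af + M * b * Df - b * (b - M / 4) * Qf)"
      unfolding E F by (simp add: field_simps power2_eq_square)
    with X e_part f_part show ?thesis by linarith
  qed
  then show ?thesis by (simp add: sum.distrib defs)
qed

section \<open>The time step restriction and the scheme in normal form\<close>

text \<open>The bound on \<open>dt\<close> is the larger root of the quadratic obtained from the
  conclusion. Once denominators are cleared, the conclusion is the condition that \<open>b\<close>
  is at most 1/4.\<close>

lemma time_step_quadratic:
  fixes \<sigma> \<epsilon> dx dt :: real
  assumes "\<sigma> > 0" and "dx > 0" and "dt > 0"
    and dt: "dt \<le> \<sigma> * dx\<^sup>2 / 4 * ((1 + sqrt (1 + (4 * \<epsilon> / (\<sigma> * dx))\<^sup>2)) / 2)"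
  shows "4 * dt\<^sup>2 \<le> dx\<^sup>2 * (\<epsilon>\<^sup>2 + \<sigma> * dt)"
proof -
  define A r where "A = \<sigma> * dx\<^sup>2 / 4" and "r = sqrt (1 + (4 * \<epsilon> / (\<sigma> * dx))\<^sup>2)"
  have "A > 0" using assms by (simp add: A_def)
  have r2: "r\<^sup>2 = 1 + (4 * \<epsilon> / (\<sigma> * dx))\<^sup>2" by (simp add: r_def add_nonneg_nonneg)
  have r1: "1 \<le> r" by (simp add: r_def)
  \<comment> \<open>The roots are \<open>A * (1 - r) / 2\<close> and \<open>A * (1 + r) / 2\<close>.
    As \<open>r\<close> is at least 1, the smaller one is nonpositive, so a positive
    \<open>dt\<close> below the larger root lies between them.\<close>
  have "A * 1 \<le> A * r" using \<open>A > 0\<close> r1 by (intro mult_left_mono) auto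
  then have "0 \<le> dt - A * (1 - r) / 2" using assms(3) by (simp add: algebra_simps)
  moreover have "dt - A * (1 + r) / 2 \<le> 0" using dt by (simp add: A_def r_def)
  ultimately have "(dt - A * (1 - r) / 2) * (dt - A * (1 + r) / 2) \<le> 0"
    by (rule mult_nonneg_nonpos)
  moreover have "(dt - A * (1 - r) / 2) * (dt - A * (1 + r) / 2)
      = dt\<^sup>2 - A * dt - A\<^sup>2 * (r\<^sup>2 - 1) / 4"
    by (simp add: power2_eq_square field_simps)
  moreover have "A\<^sup>2 * (r\<^sup>2 - 1) / 4 = dx\<^sup>2 * \<epsilon>\<^sup>2 / 4"
  proof -
    have "A * (4 * \<epsilon> / (\<sigma> * dx)) = dx * \<epsilon>"
      using assms(1,2) by (simp add: A_def power2_eq_square)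
    then show ?thesis by (metis r2 add_diff_cancel_left' power_mult_distrib)
  qed
  ultimately have "dt\<^sup>2 \<le> A * dt + dx\<^sup>2 * \<epsilon>\<^sup>2 / 4" by linarith
  then show ?thesis by (simp add: A_def algebra_simps)
qed

theorem theorem4p2:
  fixes N :: nat and \<sigma> \<epsilon> dx dt :: real and E F :: "nat \<Rightarrow> nat \<Rightarrow> real"
  assumes "\<sigma> > 0" and "\<epsilon> > 0" and "dx > 0" and "dt > 0"
    and "imex1_ctr N \<sigma> \<epsilon> dx dt E F"
    and "periodic_bc N E" and "periodic_bc N F"
    and "dt \<le> \<sigma> * dx\<^sup>2 / 4 * ((1 + sqrt (1 + (4 * \<epsilon> / (\<sigma> * dx))\<^sup>2)) / 2)"
  shows "\<forall>n. (\<Sum>j=1..N. ((E (n + 1) j)\<^sup>2 + (F (n + 1) j)\<^sup>2) * dx)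
             \<le> (\<Sum>j=1..N. ((E n j)\<^sup>2 + (F n j)\<^sup>2) * dx)"
proof
  fix n
  define M a b where "M = imex_M \<sigma> \<epsilon> dt" and "a = M * dt / (\<epsilon> * dx)"
    and "b = M * dt\<^sup>2 / (\<epsilon>\<^sup>2 * dx\<^sup>2)"
  have M_eq: "M = \<epsilon>\<^sup>2 / (\<epsilon>\<^sup>2 + \<sigma> * dt)"
    using assms(1-4) by (simp add: M_def imex_M_def field_simps)
  have pos: "0 < \<epsilon>\<^sup>2 + \<sigma> * dt" using assms(1-4) by (simp add: add_pos_pos)
  have M: "0 \<le> M" "M \<le> 1" using pos assms(1-4) by (simp_all add: M_eq)
  have ab: "a\<^sup>2 = M * b" by (simp add: a_def b_def power2_eq_square mult_ac)
  have b: "0 \<le> b" using M by (simp add: b_def)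
  have "b = dt\<^sup>2 / (dx\<^sup>2 * (\<epsilon>\<^sup>2 + \<sigma> * dt))"
    using assms(2) by (simp add: b_def M_eq mult_ac)
  then have b4: "b \<le> 1 / 4"
    using time_step_quadratic[OF assms(1,3,4,8)] pos assms(3) by (simp add: pos_divide_le_eq)
  \<comment> \<open>This identity absorbs the relaxation source into the coefficient
    \<open>M\<close> of F in the update.\<close>
  have relax: "M = 1 - dt * (M * \<sigma> / \<epsilon>\<^sup>2)"
  proof -
    have "M * \<sigma> / \<epsilon>\<^sup>2 = \<sigma> / (\<epsilon>\<^sup>2 + \<sigma> * dt)" using assms(2) by (simp add: M_eq)
    moreover have "M = 1 - dt * (\<sigma> / (\<epsilon>\<^sup>2 + \<sigma> * dt))"
      using pos by (simp add: M_eq field_simps)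
    ultimately show ?thesis by simp
  qed
  \<comment> \<open>Solves either equation for the new value. Here \<open>d\<close> stands for
    \<open>cdiff\<close>, which already contains the factor 1/2, hence \<open>2 * d\<close>;
    \<open>r\<close> is the relaxation term, zero for E.\<close>
  have step: "x' = x - a * d + b * l - dt * r"
    if "(x' - x) / dt + (M / \<epsilon>) * (2 * d / (2 * dx)) - (M * dt / \<epsilon>\<^sup>2) * (l / dx\<^sup>2) = - r"
    for x' x d l r
  proof -
    have "(x' - x) / dt = - r - (M / \<epsilon>) * (2 * d / (2 * dx)) + (M * dt / \<epsilon>\<^sup>2) * (l / dx\<^sup>2)"
      using that by simp
    then have "x' - x
        = dt * (- r - (M / \<epsilon>) * (2 * d / (2 * dx)) + (M * dt / \<epsilon>\<^sup>2) * (l / dx\<^sup>2))"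
      using assms(4) by (simp add: field_simps)
    then show ?thesis by (simp add: a_def b_def power2_eq_square algebra_simps)
  qed
  have scheme: "E (n + 1) j = E n j - a * cdiff (F n) j + b * lap (E n) j"
      "F (n + 1) j = M * F n j - a * cdiff (E n) j + b * lap (F n) j" if "j \<in> {1..N}" for j
  proof -
    have cdiff: "2 * cdiff u j = u (j + 1) - u (j - 1)" for u by (simp add: cdiff_def)
    have eqs: "(E (n + 1) j - E n j) / dt + (M / \<epsilon>) * (2 * cdiff (F n) j / (2 * dx))
          - (M * dt / \<epsilon>\<^sup>2) * (lap (E n) j / dx\<^sup>2) = - 0"
      "(F (n + 1) j - F n j) / dt + (M / \<epsilon>) * (2 * cdiff (E n) j / (2 * dx))
          - (M * dt / \<epsilon>\<^sup>2) * (lap (F n) j / dx\<^sup>2) = - (M * \<sigma> / \<epsilon>\<^sup>2 * F n j)"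
      using assms(5) that by (simp_all add: imex1_ctr_def Let_def M_def cdiff lap_def del: mult_divide_mult_cancel_left_if)
    show "E (n + 1) j = E n j - a * cdiff (F n) j + b * lap (E n) j"
      using step[OF eqs(1)] by simp
    have "M * F n j = F n j - dt * (M * \<sigma> / \<epsilon>\<^sup>2 * F n j)"
      by (subst relax) (simp add: algebra_simps)
    then show "F (n + 1) j = M * F n j - a * cdiff (E n) j + b * lap (F n) j"
      using step[OF eqs(2)] by simp
  qed
  have "periodic N (E n)" "periodic N (F n)"
    using assms(6,7) by (simp_all add: periodic_bc_def periodic_def)
  then have "(\<Sum>j=1..N. (E (n + 1) j)\<^sup>2 + (F (n + 1) j)\<^sup>2) \<le> (\<Sum>j=1..N. (E n j)\<^sup>2 + (F n j)\<^sup>2)"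
    using scheme M b b4 ab by (intro energy_step)
  then show "(\<Sum>j=1..N. ((E (n + 1) j)\<^sup>2 + (F (n + 1) j)\<^sup>2) * dx)
      \<le> (\<Sum>j=1..N. ((E n j)\<^sup>2 + (F n j)\<^sup>2) * dx)"
    using assms(3) by (simp flip: sum_distrib_right)
qed

end
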